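(* Let $C$ be a commutative ring with unity, let $n\geq 2$, and let $\mathcal{M}_n(C)$ be the $C$-algebra of all $n\times n$ matrices over $C$. Then every Jordan derivation $D:\mathcal{M}_n(C)\to\mathcal{M}_n(C)$ is an inner derivation.
   Context: Let $T$ be an algebra over a commutative ring $C$ with unity. A map $D:T\to T$ is a Jordan derivation if it is $C$-linear and $D(a^2)=D(a)a+aD(a)$ for all $a\in T$. A $C$-linear map $D:T\to T$ is a derivation if $D(ab)=D(a)b+aD(b)$ for all $a,b\in T$. A derivation $D:T\to T$ is an inner derivation if there exists $a_0\in T$ such that $D(a)=a_0a-aa_0$ for all $a\in T$. The ring $C$ is not assumed to be $2$-torsion free. *)

theory Defs
  imports "Jordan_Normal_Form.Matrix"
begin

text \<open>
  An algebra over a commutative ring is given by a \<^type>\<open>module\<close> record, whose fields \<^const>\<open>mult\<close> and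
  \<^const>\<open>one\<close> hold its ring structure; the ring of scalars is the whole type \<open>'c\<close>. Maps are only
  constrained on the carrier.
\<close>

definition linear_endo :: "('c, 'a, 'm) module_scheme \<Rightarrow> ('a \<Rightarrow> 'a) \<Rightarrow> bool" where
  "linear_endo T D \<longleftrightarrow>
     D \<in> carrier T \<rightarrow> carrier T \<and>
     (\<forall>a\<in>carrier T. \<forall>b\<in>carrier T. D (a \<oplus>\<^bsub>T\<^esub> b) = D a \<oplus>\<^bsub>T\<^esub> D b) \<and>
     (\<forall>c. \<forall>a\<in>carrier T. D (c \<odot>\<^bsub>T\<^esub> a) = c \<odot>\<^bsub>T\<^esub> D a)"

definition jordan_derivation :: "('c, 'a, 'm) module_scheme \<Rightarrow> ('a \<Rightarrow> 'a) \<Rightarrow> bool" where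
  "jordan_derivation T D \<longleftrightarrow>
     linear_endo T D \<and>
     (\<forall>a\<in>carrier T. D (a \<otimes>\<^bsub>T\<^esub> a) = (D a \<otimes>\<^bsub>T\<^esub> a) \<oplus>\<^bsub>T\<^esub> (a \<otimes>\<^bsub>T\<^esub> D a))"

definition derivation :: "('c, 'a, 'm) module_scheme \<Rightarrow> ('a \<Rightarrow> 'a) \<Rightarrow> bool" where
  "derivation T D \<longleftrightarrow>
     linear_endo T D \<and>
     (\<forall>a\<in>carrier T. \<forall>b\<in>carrier T.
        D (a \<otimes>\<^bsub>T\<^esub> b) = (D a \<otimes>\<^bsub>T\<^esub> b) \<oplus>\<^bsub>T\<^esub> (a \<otimes>\<^bsub>T\<^esub> D b))"

definition inner_derivation :: "('c, 'a, 'm) module_scheme \<Rightarrow> ('a \<Rightarrow> 'a) \<Rightarrow> bool" where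
  "inner_derivation T D \<longleftrightarrow>
     derivation T D \<and>
     (\<exists>a\<^sub>0\<in>carrier T. \<forall>a\<in>carrier T. D a = (a\<^sub>0 \<otimes>\<^bsub>T\<^esub> a) \<ominus>\<^bsub>T\<^esub> (a \<otimes>\<^bsub>T\<^esub> a\<^sub>0))"

text \<open>
  The sort \<open>{comm_ring, comm_monoid_mult}\<close> is that of commutative rings with unity. Unlike
  \<^class>\<open>comm_ring_1\<close> it does not impose \<open>0 \<noteq> 1\<close>, so the zero ring is admitted; this is also why
  \<^const>\<open>module_mat\<close>, which has the same fields, is not used here.
\<close>

definition matrix_algebra ::
    "'c :: {comm_ring, comm_monoid_mult} itself \<Rightarrow> nat \<Rightarrow> ('c, 'c mat) module" where
  "matrix_algebra ty n = \<lparr>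
     carrier = carrier_mat n n,
     mult = (*),
     one = 1\<^sub>m n,
     zero = 0\<^sub>m n n,
     add = (+),
     smult = (\<cdot>\<^sub>m)\<rparr>"

lemma matrix_algebra_simps [simp]:
  "carrier (matrix_algebra ty n) = carrier_mat n n"
  "mult (matrix_algebra ty n) = (*)"
  "one (matrix_algebra ty n) = 1\<^sub>m n"
  "zero (matrix_algebra ty n) = 0\<^sub>m n n"
  "add (matrix_algebra ty n) = (+)"
  "smult (matrix_algebra ty n) = (\<cdot>\<^sub>m)"
  by (simp_all add: matrix_algebra_def)

lemma one_mat_mult:
  fixes A :: "'c :: {comm_ring, comm_monoid_mult} mat"
  assumes "A \<in> carrier_mat n m"
  shows "1\<^sub>m n * A = A" and "A * 1\<^sub>m m = A"
  using assms
  by (auto intro!: eq_matI simp: scalar_prod_def if_distrib [of "\<lambda>x. x * _"]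
      if_distrib [of "\<lambda>x. _ * x"] cong: if_cong)

lemma ring_matrix_algebra: "ring (matrix_algebra ty n)"
proof -
  have "\<exists>B\<in>carrier_mat n n. B + A = 0\<^sub>m n n \<and> A + B = 0\<^sub>m n n"
    if "A \<in> carrier_mat n n" for A :: "'a mat"
    using that by (intro bexI [of _ "- A"]) auto
  then show ?thesis
    by unfold_locales
      (auto simp: Units_def one_mat_mult add_mult_distrib_mat mult_add_distrib_mat comm_add_mat)
qed

lemma minus_matrix_algebra:
  fixes A B :: "'c :: {comm_ring, comm_monoid_mult} mat"
  assumes "A \<in> carrier_mat n n" and "B \<in> carrier_mat n n"
  shows "A \<ominus>\<^bsub>matrix_algebra TYPE('c) n\<^esub> B = A - B"
proof -
  interpret ring "matrix_algebra TYPE('c) n" by (rule ring_matrix_algebra)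
  have "\<ominus>\<^bsub>matrix_algebra TYPE('c) n\<^esub> B = - B"
    using assms by (intro minus_equality) auto
  then show ?thesis
    using assms by (auto simp: a_minus_def intro!: eq_matI)
qed

end

theory Submission
  imports Defs
begin

text \<open>
  Comparing entries in \<open>D(e\<^sub>i\<^sub>i) = D(e\<^sub>i\<^sub>i)e\<^sub>i\<^sub>i + e\<^sub>i\<^sub>iD(e\<^sub>i\<^sub>i)\<close> and in the linearized identity for
  \<open>e\<^sub>i\<^sub>i\<close>, \<open>e\<^sub>j\<^sub>j\<close> shows that \<open>D\<close> agrees on the diagonal idempotents with the commutator by the matrix
  whose \<open>j\<close>-th column is that of \<open>D(e\<^sub>j\<^sub>j)\<close>. Subtracting it, we may assume \<open>D(e\<^sub>i\<^sub>i) = 0\<close>. For \<open>i \<noteq> j\<close>,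
  \<open>e\<^sub>i\<^sub>ie\<^sub>i\<^sub>j + e\<^sub>i\<^sub>je\<^sub>i\<^sub>i = e\<^sub>i\<^sub>j = e\<^sub>j\<^sub>je\<^sub>i\<^sub>j + e\<^sub>i\<^sub>je\<^sub>j\<^sub>j\<close> leaves only the positions \<open>(i,j)\<close> and \<open>(j,i)\<close> for
  \<open>D(e\<^sub>i\<^sub>j)\<close>. The second one is excluded by \<open>e\<^sub>i\<^sub>j\<^sup>2 = 0\<close>; this is where the identity on squares, and not
  just its linearization, is needed when 2 is not invertible. So \<open>D(e\<^sub>i\<^sub>j) = \<alpha>\<^sub>i\<^sub>je\<^sub>i\<^sub>j\<close> with
  \<open>\<alpha>\<^sub>i\<^sub>j + \<alpha>\<^sub>j\<^sub>k = \<alpha>\<^sub>i\<^sub>k\<close>, and \<open>D\<close> is the commutator by the diagonal matrix with entries \<open>\<alpha>\<^sub>i\<^sub>0\<close>.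
\<close>

section \<open>Commutators and matrix units\<close>

definition commutator :: "'c :: comm_ring mat \<Rightarrow> 'c mat \<Rightarrow> 'c mat" where
  "commutator A X = A * X - X * A"

definition mat_unit :: "nat \<Rightarrow> nat \<Rightarrow> nat \<Rightarrow> 'c :: {zero, one} mat" where
  "mat_unit n i j = mat n n (\<lambda>(k, l). if k = i \<and> l = j then 1 else 0)"

lemma mat_unit_carrier [simp]: "mat_unit n i j \<in> carrier_mat n n"
  by (simp add: mat_unit_def)

lemma mat_unit_dims [simp]:
  "dim_row (mat_unit n i j) = n" "dim_col (mat_unit n i j) = n"
  by (simp_all add: mat_unit_def)

lemma index_mat_unit [simp]:
  "k < n \<Longrightarrow> l < n \<Longrightarrow> mat_unit n i j $$ (k, l) = (if k = i \<and> l = j then 1 else 0)"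
  by (simp add: mat_unit_def)

text \<open>Right multiplication by a matrix unit moves one column and left multiplication moves one
  row. The indices are swapped in the second equation so that \<open>i\<close> is the contracted
  index in both.\<close>

lemma index_mult_mat_unit [simp]:
  fixes A :: "'c :: {comm_ring, comm_monoid_mult} mat"
  assumes "A \<in> carrier_mat n n" "k < n" "l < n" "i < n"
  shows "(A * mat_unit n i j) $$ (k, l) = (if l = j then A $$ (k, i) else 0)"
    and "(mat_unit n j i * A) $$ (k, l) = (if k = j then A $$ (i, l) else 0)"
  using assms
  by (simp_all add: mat_unit_def scalar_prod_def if_distrib [of "\<lambda>x. x * _"]
      if_distrib [of "\<lambda>x. _ * x"] cong: if_cong)

lemma mat_unit_mult_mat_unit:
  assumes "i < n" "j < n" "r < n" "s < n"
  shows "mat_unit n i j * mat_unit n r s =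
    (if j = r then mat_unit n i s else 0\<^sub>m n n :: 'c :: {comm_ring, comm_monoid_mult} mat)"
  using assms by (intro eq_matI) (auto simp del: index_mult_mat(1))

section \<open>Linear maps on the matrix algebra\<close>

lemma linear_endo_matrix_algebraD:
  fixes D :: "'c :: {comm_ring, comm_monoid_mult} mat \<Rightarrow> 'c mat"
  assumes "linear_endo (matrix_algebra TYPE('c) n) D"
  shows "X \<in> carrier_mat n n \<Longrightarrow> D X \<in> carrier_mat n n"
    and "X \<in> carrier_mat n n \<Longrightarrow> Y \<in> carrier_mat n n \<Longrightarrow> D (X + Y) = D X + D Y"
    and "X \<in> carrier_mat n n \<Longrightarrow> D (c \<cdot>\<^sub>m X) = c \<cdot>\<^sub>m D X"
    and "D (0\<^sub>m n n) = 0\<^sub>m n n"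
proof -
  show D: "X \<in> carrier_mat n n \<Longrightarrow> D X \<in> carrier_mat n n" for X
    using assms by (auto simp: linear_endo_def)
  show "X \<in> carrier_mat n n \<Longrightarrow> Y \<in> carrier_mat n n \<Longrightarrow> D (X + Y) = D X + D Y"
    using assms by (auto simp: linear_endo_def)
  show smult: "X \<in> carrier_mat n n \<Longrightarrow> D (c \<cdot>\<^sub>m X) = c \<cdot>\<^sub>m D X" for X c
    using assms by (auto simp: linear_endo_def)
  have "0 \<cdot>\<^sub>m X = 0\<^sub>m n n" if "X \<in> carrier_mat n n" for X :: "'c mat"
    by (rule eq_matI) (use that in auto)
  then show "D (0\<^sub>m n n) = 0\<^sub>m n n"
    using smult[of "0\<^sub>m n n" 0] D[of "0\<^sub>m n n"] by simp
qed

text \<open>The matrix units span the algebra. The induction runs over a finite set of positions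
  containing the support and peels off one entry at a time.\<close>

lemma linear_endo_eqI:
  fixes D D' :: "'c :: {comm_ring, comm_monoid_mult} mat \<Rightarrow> 'c mat"
  assumes D: "linear_endo (matrix_algebra TYPE('c) n) D"
    and D': "linear_endo (matrix_algebra TYPE('c) n) D'"
    and eq: "\<And>i j. i < n \<Longrightarrow> j < n \<Longrightarrow> D (mat_unit n i j) = D' (mat_unit n i j)"
    and X: "X \<in> carrier_mat n n"
  shows "D X = D' X"
proof -
  note lin = linear_endo_matrix_algebraD[OF D] linear_endo_matrix_algebraD[OF D']
  have "D X = D' X"
    if "finite S" "S \<subseteq> {..<n} \<times> {..<n}" "X \<in> carrier_mat n n"
      "\<And>i j. i < n \<Longrightarrow> j < n \<Longrightarrow> (i, j) \<notin> S \<Longrightarrow> X $$ (i, j) = 0" for S X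
    using that
  proof (induction S arbitrary: X rule: finite_induct)
    case empty
    then have "X = 0\<^sub>m n n" by (intro eq_matI) auto
    then show ?case by (simp add: lin)
  next
    case (insert p S)
    obtain i j where p: "p = (i, j)" by (cases p)
    with insert.prems have ij: "i < n" "j < n" by auto
    \<comment> \<open>Erasing the entry at \<open>p\<close> leaves a matrix supported in
      \<open>S\<close>, to which the induction hypothesis applies.\<close>
    define Y where "Y = mat n n (\<lambda>q. if q = p then 0 else X $$ q)"
    have Y: "Y \<in> carrier_mat n n" by (simp add: Y_def)
    have "D Y = D' Y"
      using insert.prems Y by (intro insert.IH) (auto simp: Y_def)
    moreover have "X = X $$ (i, j) \<cdot>\<^sub>m mat_unit n i j + Y"
      by (rule eq_matI) (use insert.prems in \<open>auto simp: Y_def p mat_unit_def\<close>)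
    moreover have "D (c \<cdot>\<^sub>m mat_unit n i j + Y) = c \<cdot>\<^sub>m D (mat_unit n i j) + D Y"
        "D' (c \<cdot>\<^sub>m mat_unit n i j + Y) = c \<cdot>\<^sub>m D' (mat_unit n i j) + D' Y" for c
      using Y by (simp_all add: lin)
    ultimately show ?case
      using eq[OF ij] by metis
  qed
  from this[of "{..<n} \<times> {..<n}" X] show ?thesis
    using X by auto
qed

section \<open>Commutators are derivations\<close>

lemma commutator_carrier [simp]:
  "A \<in> carrier_mat n n \<Longrightarrow> X \<in> carrier_mat n n \<Longrightarrow> commutator A X \<in> carrier_mat n n"
  by (simp add: commutator_def minus_carrier_mat)

lemma dim_commutator [simp]:
  "dim_row (commutator A X) = dim_row X" "dim_col (commutator A X) = dim_col A"
  by (simp_all add: commutator_def)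

lemma derivation_commutator:
  fixes A :: "'c :: {comm_ring, comm_monoid_mult} mat"
  assumes A: "A \<in> carrier_mat n n"
  shows "derivation (matrix_algebra TYPE('c) n) (commutator A)"
proof -
  have "commutator A (X + Y) = commutator A X + commutator A Y"
    if "X \<in> carrier_mat n n" "Y \<in> carrier_mat n n" for X Y
    using A that
    by (auto simp: commutator_def mult_add_distrib_mat[of _ n n _ n] add_mult_distrib_mat[of _ n n _ _ n]
        intro!: eq_matI)
  moreover have "commutator A (c \<cdot>\<^sub>m X) = c \<cdot>\<^sub>m commutator A X" if "X \<in> carrier_mat n n" for c X
    using A that
    by (auto simp: commutator_def mult_smult_distrib[of _ n n] mult_smult_assoc_mat[of _ n n]
        right_diff_distrib intro!: eq_matI)
  moreover have "commutator A (X * Y) = commutator A X * Y + X * commutator A Y"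
    if XY: "X \<in> carrier_mat n n" "Y \<in> carrier_mat n n" for X Y
  proof -
    \<comment> \<open>In the sum of the next two expansions the middle term \<open>X * A * Y\<close>
      cancels.\<close>
    have "commutator A X * Y = A * X * Y - X * A * Y"
      using A XY by (simp add: commutator_def minus_mult_distrib_mat[of _ n n _ _ n])
    moreover have "X * commutator A Y = X * A * Y - X * Y * A"
      using A XY by (simp add: commutator_def mult_minus_distrib_mat[of _ n n _ n] assoc_mult_mat[of _ n n _ n _ n])
    moreover have "commutator A (X * Y) = A * X * Y - X * Y * A"
      using A XY by (simp add: commutator_def assoc_mult_mat[of _ n n _ n _ n])
    ultimately show ?thesis
      using A XY by (auto intro!: eq_matI)
  qed
  ultimately show ?thesis
    using A by (auto simp: derivation_def linear_endo_def)
qed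

section \<open>Jordan derivations: differences, linearization, and entries at matrix units\<close>

lemma derivation_imp_jordan_derivation:
  "derivation T D \<Longrightarrow> jordan_derivation T D"
  by (simp add: derivation_def jordan_derivation_def)

text \<open>This allows a commutator to be subtracted from \<open>D\<close> without losing the
  Jordan identity.\<close>

lemma jordan_derivation_diff:
  fixes D D' :: "'c :: {comm_ring, comm_monoid_mult} mat \<Rightarrow> 'c mat"
  assumes D: "jordan_derivation (matrix_algebra TYPE('c) n) D"
    and D': "jordan_derivation (matrix_algebra TYPE('c) n) D'"
  shows "jordan_derivation (matrix_algebra TYPE('c) n) (\<lambda>X. D X - D' X)"
proof -
  note lin = linear_endo_matrix_algebraD[of n D] linear_endo_matrix_algebraD[of n D']
  have l: "linear_endo (matrix_algebra TYPE('c) n) D" "linear_endo (matrix_algebra TYPE('c) n) D'"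
    using D D' by (simp_all add: jordan_derivation_def)
  have c: "D X \<in> carrier_mat n n" "D' X \<in> carrier_mat n n" if "X \<in> carrier_mat n n" for X
    using that lin l by blast+
  have "D (X * X) - D' (X * X) = (D X - D' X) * X + X * (D X - D' X)"
    if X: "X \<in> carrier_mat n n" for X
  proof -
    have "D (X * X) = D X * X + X * D X" "D' (X * X) = D' X * X + X * D' X"
      using D D' X by (auto simp: jordan_derivation_def)
    then show ?thesis
      using X c[OF X]
      by (auto simp: minus_mult_distrib_mat[of _ n n _ _ n] mult_minus_distrib_mat[of _ n n _ n] intro!: eq_matI)
  qed
  moreover have "D (X + Y) - D' (X + Y) = D X - D' X + (D Y - D' Y)"
    if "X \<in> carrier_mat n n" "Y \<in> carrier_mat n n" for X Y
    using that
    by (intro eq_matI) (simp_all add: lin l carrier_matD[OF c(1)] carrier_matD[OF c(2)])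
  moreover have "D (a \<cdot>\<^sub>m X) - D' (a \<cdot>\<^sub>m X) = a \<cdot>\<^sub>m (D X - D' X)"
    if "X \<in> carrier_mat n n" for a X
    using that
    by (intro eq_matI) (simp_all add: lin l carrier_matD[OF c(1)] carrier_matD[OF c(2)] right_diff_distrib)
  ultimately show ?thesis
    using c by (auto simp: jordan_derivation_def linear_endo_def minus_carrier_mat)
qed

text \<open>Expand the identity for the square of \<open>X + Y\<close> and cancel the identities for
  \<open>X * X\<close> and \<open>Y * Y\<close>; nothing is divided by 2.\<close>

lemma jordan_derivation_linearized:
  fixes D :: "'c :: {comm_ring, comm_monoid_mult} mat \<Rightarrow> 'c mat"
  assumes D: "jordan_derivation (matrix_algebra TYPE('c) n) D"
    and X: "X \<in> carrier_mat n n" and Y: "Y \<in> carrier_mat n n"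
  shows "D (X * Y + Y * X) = (D X * Y + X * D Y) + (D Y * X + Y * D X)"
proof -
  have l: "linear_endo (matrix_algebra TYPE('c) n) D"
    and sq: "\<And>Z. Z \<in> carrier_mat n n \<Longrightarrow> D (Z * Z) = D Z * Z + Z * D Z"
    using D by (simp_all add: jordan_derivation_def)
  note lin = linear_endo_matrix_algebraD[OF l]
  have c [simp]: "X * X \<in> carrier_mat n n" "Y * Y \<in> carrier_mat n n" "X * Y \<in> carrier_mat n n"
     "Y * X \<in> carrier_mat n n" "D X \<in> carrier_mat n n" "D Y \<in> carrier_mat n n"
    using X Y lin(1) by auto
  note dims = carrier_matD[OF X] carrier_matD[OF Y] carrier_matD[OF c(5)] carrier_matD[OF c(6)]
  have e: "(X + Y) * (X + Y) = (X * X + Y * Y) + (X * Y + Y * X)"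
    using X Y
    by (auto simp: mult_add_distrib_mat[of _ n n _ n] add_mult_distrib_mat[of _ n n _ _ n] ac_simps dims
        simp del: index_mult_mat(1) intro!: eq_matI)
  have "D (X * X + Y * Y) + D (X * Y + Y * X) = (D X + D Y) * (X + Y) + (X + Y) * (D X + D Y)"
    using sq[of "X + Y"] X Y by (simp add: e lin)
  then have "(D X * X + X * D X) + (D Y * Y + Y * D Y) + D (X * Y + Y * X)
      = (D X + D Y) * (X + Y) + (X + Y) * (D X + D Y)"
    using X Y by (simp add: lin sq)
  also have "\<dots> = (D X * X + D X * Y + (D Y * X + D Y * Y)) + (X * D X + X * D Y + (Y * D X + Y * D Y))"
    using X Y
    by (auto simp: mult_add_distrib_mat[of _ n n _ n] add_mult_distrib_mat[of _ n n _ _ n] ac_simps dims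
        simp del: index_mult_mat(1) intro!: eq_matI)
  finally have s: "(D X * X + X * D X) + (D Y * Y + Y * D Y) + D (X * Y + Y * X)
      = (D X * X + D X * Y + (D Y * X + D Y * Y)) + (X * D X + X * D Y + (Y * D X + Y * D Y))" .
  have D_c: "D (X * Y + Y * X) \<in> carrier_mat n n" by (simp add: lin)
  show ?thesis
  proof (rule eq_matI)
    fix k l
    assume "k < dim_row (D X * Y + X * D Y + (D Y * X + Y * D X))"
      "l < dim_col (D X * Y + X * D Y + (D Y * X + Y * D X))"
    then have kl: "k < n" "l < n" using X Y by (auto simp: dims)
    note carr = X Y c D_c dims carrier_matD[OF D_c]
    \<comment> \<open>Cancellation is done on entries, which lie in the additive group of
      \<open>'c\<close>. Here \<open>a\<close>, \<open>b\<close>, \<open>c\<close>, \<open>d\<close>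
      come from the two squares, and \<open>x\<close> from \<open>D (X * Y + Y * X)\<close>.\<close>
    have cancel: "x = e + g + (f + h)"
      if "a + b + (c + d) + x = (a + e + (f + c)) + (b + g + (h + d))" for a b c d e f g h x :: 'c
    proof -
      have "(a + b + c + d) + x = (a + b + c + d) + (e + g + (f + h))"
        using that by (simp only: ac_simps)
      then show ?thesis by (simp only: add_left_cancel)
    qed
    have "(D X * X) $$ (k, l) + (X * D X) $$ (k, l) + ((D Y * Y) $$ (k, l) + (Y * D Y) $$ (k, l)) +
        D (X * Y + Y * X) $$ (k, l) =
      ((D X * X) $$ (k, l) + (D X * Y) $$ (k, l) + ((D Y * X) $$ (k, l) + (D Y * Y) $$ (k, l))) +
        ((X * D X) $$ (k, l) + (X * D Y) $$ (k, l) + ((Y * D X) $$ (k, l) + (Y * D Y) $$ (k, l)))"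
      using arg_cong[OF s, of "\<lambda>M. M $$ (k, l)"] kl
      by (simp add: carr del: index_mult_mat(1) add_left_cancel add_right_cancel)
    from cancel[OF this]
    show "D (X * Y + Y * X) $$ (k, l) = (D X * Y + X * D Y + (D Y * X + Y * D X)) $$ (k, l)"
      using kl by (simp add: carr del: index_mult_mat(1))
  qed (simp_all add: dims carrier_matD[OF D_c])
qed

text \<open>The product stays unevaluated under \<open>D\<close>, since its value depends on whether
  \<open>i = j\<close>: both the idempotent and the square-zero case are used later.\<close>

lemma jordan_derivation_mat_unit_sq:
  fixes D :: "'c :: {comm_ring, comm_monoid_mult} mat \<Rightarrow> 'c mat"
  assumes D: "jordan_derivation (matrix_algebra TYPE('c) n) D"
    and "i < n" "j < n" "k < n" "l < n"
  shows "D (mat_unit n i j * mat_unit n i j) $$ (k, l) =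
    (if l = j then D (mat_unit n i j) $$ (k, i) else 0) +
    (if k = i then D (mat_unit n i j) $$ (j, l) else 0)"
proof -
  have c: "D (mat_unit n i j) \<in> carrier_mat n n"
    using D by (auto simp: jordan_derivation_def linear_endo_def)
  moreover have "D (mat_unit n i j * mat_unit n i j)
      = D (mat_unit n i j) * mat_unit n i j + mat_unit n i j * D (mat_unit n i j)"
    using D by (simp add: jordan_derivation_def)
  ultimately show ?thesis
    using assms carrier_matD[OF c]
    by (simp del: index_mult_mat(1))
qed

lemma jordan_derivation_mat_unit_linearized:
  fixes D :: "'c :: {comm_ring, comm_monoid_mult} mat \<Rightarrow> 'c mat"
  assumes D: "jordan_derivation (matrix_algebra TYPE('c) n) D"
    and "i < n" "j < n" "r < n" "s < n" "k < n" "l < n"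
  shows "D (mat_unit n i j * mat_unit n r s + mat_unit n r s * mat_unit n i j) $$ (k, l) =
    (if l = s then D (mat_unit n i j) $$ (k, r) else 0) +
    (if k = i then D (mat_unit n r s) $$ (j, l) else 0) +
    ((if l = j then D (mat_unit n r s) $$ (k, i) else 0) +
    (if k = r then D (mat_unit n i j) $$ (s, l) else 0))"
proof -
  have c: "D (mat_unit n i j) \<in> carrier_mat n n" for i j
    using D by (auto simp: jordan_derivation_def linear_endo_def)
  show ?thesis
    unfolding jordan_derivation_linearized[OF D mat_unit_carrier mat_unit_carrier]
    using assms c carrier_matD[OF c]
    by (simp del: index_mult_mat(1))
qed

section \<open>Reduction to commutators\<close>

lemma jordan_derivation_diagonal_units:
  fixes D :: "'c :: {comm_ring, comm_monoid_mult} mat \<Rightarrow> 'c mat"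
  assumes D: "jordan_derivation (matrix_algebra TYPE('c) n) D"
  obtains A where "A \<in> carrier_mat n n"
    and "\<And>i. i < n \<Longrightarrow> D (mat_unit n i i) = commutator A (mat_unit n i i)"
proof
  define A where "A = mat n n (\<lambda>(k, j). D (mat_unit n j j) $$ (k, j))"
  show A: "A \<in> carrier_mat n n" by (simp add: A_def)
  have D_carrier: "D (mat_unit n i j) \<in> carrier_mat n n" for i j
    using D by (auto simp: jordan_derivation_def linear_endo_def)
  have D0: "D (0\<^sub>m n n) = 0\<^sub>m n n"
    using D by (intro linear_endo_matrix_algebraD) (simp add: jordan_derivation_def)
  fix i assume i: "i < n"
  show "D (mat_unit n i i) = commutator A (mat_unit n i i)"
  proof (rule eq_matI)
    fix k l
    assume "k < dim_row (commutator A (mat_unit n i i))" "l < dim_col (commutator A (mat_unit n i i))"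
    then have kl: "k < n" "l < n" using A by auto
    have sq: "D (mat_unit n i i) $$ (k, l) =
        (if l = i then D (mat_unit n i i) $$ (k, i) else 0) +
        (if k = i then D (mat_unit n i i) $$ (i, l) else 0)"
      using jordan_derivation_mat_unit_sq[OF D i i kl] i by (simp add: mat_unit_mult_mat_unit)
    \<comment> \<open>Distinct diagonal idempotents annihilate each other; this is their linearized
      identity at position \<open>(i, l)\<close>.\<close>
    have orth: "D (mat_unit n l l) $$ (i, l) + D (mat_unit n i i) $$ (i, l) = 0" if "l \<noteq> i"
      using jordan_derivation_mat_unit_linearized[OF D i i kl(2) kl(2) i kl(2)] i kl that
      by (simp add: mat_unit_mult_mat_unit D0 add.commute)
    have "commutator A (mat_unit n i i) $$ (k, l) =
        (if l = i then A $$ (k, i) else 0) - (if k = i then A $$ (i, l) else 0)"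
      unfolding commutator_def
      using A i kl carrier_matD[OF A]
      by (simp del: index_mult_mat(1))
    \<comment> \<open>Column \<open>i\<close> agrees by the choice of \<open>A\<close>, and row
      \<open>i\<close> by \<open>orth\<close>. At \<open>(i, i)\<close>, \<open>sq\<close> reads x =
      x + x, so both sides are 0.\<close>
    also have "\<dots> = D (mat_unit n i i) $$ (k, l)"
      using sq orth i kl by (auto simp: A_def neg_eq_iff_add_eq_0 add.commute split: if_splits)
    finally show "D (mat_unit n i i) $$ (k, l) = commutator A (mat_unit n i i) $$ (k, l)" ..
  qed (simp_all add: carrier_matD[OF A] carrier_matD[OF D_carrier])
qed

lemma jordan_derivation_vanishing_on_diagonal_units:
  fixes D :: "'c :: {comm_ring, comm_monoid_mult} mat \<Rightarrow> 'c mat"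
  assumes D: "jordan_derivation (matrix_algebra TYPE('c) n) D"
    and D_diag: "\<And>i. i < n \<Longrightarrow> D (mat_unit n i i) = 0\<^sub>m n n"
  obtains A where "A \<in> carrier_mat n n"
    and "\<And>X. X \<in> carrier_mat n n \<Longrightarrow> D X = commutator A X"
proof
  define \<alpha> where "\<alpha> i j = D (mat_unit n i j) $$ (i, j)" for i j
  \<comment> \<open>Index 0 is a base point: by \<open>cocycle\<close>, the difference of the
    diagonal entries at \<open>i\<close> and \<open>j\<close> is
    \<open>\<alpha> i j\<close>.\<close>
  define A where "A = mat n n (\<lambda>(i, j). if i = j then \<alpha> i 0 else 0)"
  show A: "A \<in> carrier_mat n n" by (simp add: A_def)
  have linear: "linear_endo (matrix_algebra TYPE('c) n) D"
    using D by (simp add: jordan_derivation_def)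
  have D_carrier: "D (mat_unit n i j) \<in> carrier_mat n n" for i j
    using linear by (auto simp: linear_endo_def)
  have D0: "D (0\<^sub>m n n) = 0\<^sub>m n n"
    using linear by (rule linear_endo_matrix_algebraD)
  have entry: "D (mat_unit n i j) $$ (k, l) = (if k = i \<and> l = j then \<alpha> i j else 0)"
    if ij: "i < n" "j < n" and kl: "k < n" "l < n" for i j k l
  proof (cases "i = j")
    case True
    then show ?thesis
      using D_diag[of i] ij kl by (simp add: \<alpha>_def)
  next
    case False
    \<comment> \<open>\<open>row\<close> confines the support to row \<open>i\<close> and column
      \<open>i\<close>, \<open>col\<close> to row \<open>j\<close> and column \<open>j\<close>.
      These two crosses meet only in \<open>(i, j)\<close> and \<open>(j, i)\<close>.\<close>
    have row: "D (mat_unit n i j) $$ (k, l) =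
        (if k = i then D (mat_unit n i j) $$ (i, l) else 0) +
        (if l = i then D (mat_unit n i j) $$ (k, i) else 0)"
      if "k < n" "l < n" for k l
      using jordan_derivation_mat_unit_linearized[OF D ij(1) ij(1) ij that] ij that False D_carrier
      by (simp add: mat_unit_mult_mat_unit D_diag cong: if_cong)
    have col: "D (mat_unit n i j) $$ (k, l) =
        (if l = j then D (mat_unit n i j) $$ (k, j) else 0) +
        (if k = j then D (mat_unit n i j) $$ (j, l) else 0)"
      if "k < n" "l < n" for k l
      using jordan_derivation_mat_unit_linearized[OF D ij ij(2) ij(2) that] ij that False D_carrier
      by (simp add: mat_unit_mult_mat_unit D_diag cong: if_cong)
    \<comment> \<open>The identity for the zero square, read at position \<open>(i, i)\<close>,
      isolates this entry.\<close>
    have "D (mat_unit n i j) $$ (j, i) = 0"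
      using jordan_derivation_mat_unit_sq[OF D ij ij(1) ij(1)] ij False
      by (simp add: mat_unit_mult_mat_unit D0)
    then show ?thesis
      using row[OF kl] col[OF kl] row[of i i] col[of j j] ij kl False
      by (auto simp: \<alpha>_def split: if_splits)
  qed
  have diag: "\<alpha> i i = 0" if "i < n" for i
    using that by (simp add: \<alpha>_def D_diag)
  have cocycle: "\<alpha> i j + \<alpha> j k = \<alpha> i k" if ijk: "i < n" "j < n" "k < n" for i j k
  proof (cases "i = j \<or> j = k")
    case True
    then show ?thesis using ijk diag by auto
  next
    case False
    show ?thesis
    proof (cases "k = i")
      case True
      \<comment> \<open>For \<open>k = i\<close> the symmetrized product of the units at
        \<open>(i, j)\<close> and \<open>(j, i)\<close> is this sum, so \<alpha> is
        antisymmetric.\<close>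
      have "D (mat_unit n i i + mat_unit n j j) = 0\<^sub>m n n"
        using ijk by (simp add: linear_endo_matrix_algebraD[OF linear] D_diag)
      then show ?thesis
        using jordan_derivation_mat_unit_linearized[OF D ijk(1,2) ijk(2,1) ijk(1) ijk(1)] ijk False True
        by (simp add: mat_unit_mult_mat_unit entry diag)
    next
      case False': False
      show ?thesis
        \<comment> \<open>For distinct indices the reversed product vanishes, and position
          \<open>(i, k)\<close> of the linearized identity is the claim.\<close>
        using jordan_derivation_mat_unit_linearized[OF D ijk(1,2) ijk(2,3) ijk(1) ijk(3)]
          ijk False False'
        by (simp add: mat_unit_mult_mat_unit entry cong: if_cong)
    qed
  qed
  have "D (mat_unit n i j) = commutator A (mat_unit n i j)" if ij: "i < n" "j < n" for i j
  proof (rule eq_matI)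
    fix k l
    assume "k < dim_row (commutator A (mat_unit n i j))" "l < dim_col (commutator A (mat_unit n i j))"
    then have kl: "k < n" "l < n" using A by auto
    have "commutator A (mat_unit n i j) $$ (k, l) =
        (if l = j then A $$ (k, i) else 0) - (if k = i then A $$ (j, l) else 0)"
      unfolding commutator_def
      using A ij kl carrier_matD[OF A]
      by (simp del: index_mult_mat(1))
    also have "\<dots> = (if k = i \<and> l = j then \<alpha> i 0 - \<alpha> j 0 else 0)"
      using ij kl by (auto simp: A_def)
    \<comment> \<open>The base point is a valid index because \<open>i < n\<close> gives
      \<open>0 < n\<close>.\<close>
    also have "\<alpha> i 0 - \<alpha> j 0 = \<alpha> i j"
      using cocycle[OF ij, of 0] ij by (simp add: diff_eq_eq)
    finally show "D (mat_unit n i j) $$ (k, l) = commutator A (mat_unit n i j) $$ (k, l)"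
      using entry[OF ij kl] by simp
  qed (simp_all add: carrier_matD[OF A] carrier_matD[OF D_carrier])
  then show "D X = commutator A X" if "X \<in> carrier_mat n n" for X
    using linear_endo_eqI[OF linear, of "commutator A" X] derivation_commutator[OF A] that
    by (simp add: derivation_def)
qed

section \<open>Assembling the inner derivation\<close>

theorem corollary3p1:
  fixes n :: nat
    and D :: "'c :: {comm_ring, comm_monoid_mult} mat \<Rightarrow> 'c mat"
  assumes "n \<ge> 2"
    and "jordan_derivation (matrix_algebra TYPE('c) n) D"
  shows "inner_derivation (matrix_algebra TYPE('c) n) D"
proof -
  obtain A where A: "A \<in> carrier_mat n n"
    and DA: "\<And>i. i < n \<Longrightarrow> D (mat_unit n i i) = commutator A (mat_unit n i i)"
    using jordan_derivation_diagonal_units[OF assms(2)] by blast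
  have "jordan_derivation (matrix_algebra TYPE('c) n) (\<lambda>X. D X - commutator A X)"
    using derivation_commutator[OF A]
    by (intro jordan_derivation_diff[OF assms(2)] derivation_imp_jordan_derivation)
  then obtain B where B: "B \<in> carrier_mat n n"
    and DB: "\<And>X. X \<in> carrier_mat n n \<Longrightarrow> D X - commutator A X = commutator B X"
    by (rule jordan_derivation_vanishing_on_diagonal_units)
      (use DA commutator_carrier[OF A mat_unit_carrier] in \<open>auto intro: minus_r_inv_mat\<close>)
  \<comment> \<open>Commutators are additive in their first argument, so the two reductions combine
    into the single witness \<open>A + B\<close>.\<close>
  have AB: "A + B \<in> carrier_mat n n" using A B by simp
  have D_closed: "D X \<in> carrier_mat n n" if "X \<in> carrier_mat n n" for X
    using assms(2) that by (auto simp: jordan_derivation_def linear_endo_def)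
  have D_eq: "D X = commutator (A + B) X" if X: "X \<in> carrier_mat n n" for X
  proof -
    have "D X = commutator A X + (D X - commutator A X)"
      by (rule eq_matI) (use D_closed[OF X] commutator_carrier[OF A X] in auto)
    also have "\<dots> = commutator A X + commutator B X"
      by (simp add: DB X)
    also have "\<dots> = commutator (A + B) X"
      using A B X
      by (auto simp: commutator_def mult_add_distrib_mat[of _ n n _ n] add_mult_distrib_mat[of _ n n _ _ n]
          intro!: eq_matI)
    finally show ?thesis .
  qed
  have "derivation (matrix_algebra TYPE('c) n) D"
    using derivation_commutator[OF AB] assms(2)
    by (simp add: derivation_def jordan_derivation_def D_eq)
  moreover have "D X = (A + B) * X \<ominus>\<^bsub>matrix_algebra TYPE('c) n\<^esub> X * (A + B)"
    if "X \<in> carrier_mat n n" for X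
    using that AB by (subst minus_matrix_algebra) (auto simp: D_eq commutator_def)
  ultimately show ?thesis
    using AB by (auto simp: inner_derivation_def)
qed

end
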